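(* Let $\nu_0=\sqrt{1-\sin^2 1}$ and $\nu_1=-\dfrac{\sin 2}{1+\cos 2}$. Let $\beta_1,\beta_2>0$ be real numbers and $f\in\mathcal{A}$. Let $$S_f(z):=1+\beta_1(S_2-S_1^2+S_1)+\beta_2(S_3+2S_2+2S_1^3-2S_1^2-3S_1S_2),$$ where $S_1=zf'(z)/f(z)$, $S_2=z^2f''(z)/f(z)$ and $S_3=z^3f'''(z)/f(z)$. Then $f\in\mathcal{S}^*_s$ if any one of the following conditions holds: (i) $S_f(z)\prec (1+Cz)/(1+Dz)$ and $\nu_0(\beta_1+\beta_2\nu_1)(1-D^2)\geq (C-D)(1+|D|)$, where $-1<D<C\leq 1$. (ii) $S_f(z)\prec 2/(1+e^{-z})$ and $\nu_0(\beta_1+\beta_2\nu_1)\geq r_0$, where $r_0\approx 0.546302$ is the positive root of the equation $r^2+2\cot(1)\,r-1=0$. (iii) $S_f(z)\prec z+\sqrt{1+z^2}$ and $\nu_0(\beta_1+\beta_2\nu_1)\geq\sqrt{2}$. (iv) $S_f(z)\prec 1+ze^z$ and $\nu_0(\beta_1+\beta_2\nu_1)\geq e$. (v) $S_f(z)\prec 1+\sinh^{-1}z$ and $2\nu_0(\beta_1+\beta_2\nu_1)\geq\pi$. (vi) $S_f(z)\prec e^z$ and $\nu_0(\beta_1+\beta_2\nu_1)\geq e-1$. (vii) $S_f(z)\prec 1+\sin z$ and $\nu_0(\beta_1+\beta_2\nu_1)\geq\sinh 1$.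
   Context: $\mathbb{D}=\{z\in\mathbb{C}:|z|<1\}$. $\mathcal{A}$ is the class of analytic functions on $\mathbb{D}$ of the form $f(z)=z+a_2z^2+a_3z^3+\cdots$. For functions $f,g$ analytic in $\mathbb{D}$, $f\prec g$ ($f$ is subordinate to $g$) means there is an analytic $w:\mathbb{D}\to\mathbb{C}$ with $w(0)=0$ and $|w(z)|\leq|z|$ such that $f(z)=g(w(z))$ for all $z\in\mathbb{D}$. $\mathcal{S}^*_s$ is the class of $f\in\mathcal{A}$ with $zf'(z)/f(z)\prec 1+\sin z$. Quotients such as $zf'(z)/f(z)$ are understood with their removable singularity at $0$ filled in. The square root is the principal branch, and $\sinh^{-1}z=\log(z+\sqrt{1+z^2})$ is the principal branch of the inverse hyperbolic sine, analytic on $\mathbb{D}$ with value $0$ at $0$. Numerically $\nu_0\approx 0.540302$, $\nu_1\approx -1.55741$. *)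

theory Defs
  imports "HOL-Complex_Analysis.Complex_Analysis"
begin

abbreviation unit_disc :: "complex set" where
  "unit_disc \<equiv> ball 0 1"

text \<open>The condition \<open>f(z) = z + a\<^sub>2 z\<^sup>2 + a\<^sub>3 z\<^sup>3 + \<dots>\<close> is the normalisation
  \<open>f(0) = 0\<close>, \<open>f'(0) = 1\<close>. Values of \<open>f\<close> outside the disc are irrelevant.\<close>
definition class_A :: "(complex \<Rightarrow> complex) set" where
  "class_A = {f. f holomorphic_on unit_disc \<and> f 0 = 0 \<and> deriv f 0 = 1}"

definition subordinate :: "(complex \<Rightarrow> complex) \<Rightarrow> (complex \<Rightarrow> complex) \<Rightarrow> bool"
    (infix "\<prec>\<^sub>s" 50) where
  "f \<prec>\<^sub>s g \<longleftrightarrow> f holomorphic_on unit_disc \<and> g holomorphic_on unit_disc \<and>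
     (\<exists>w. w holomorphic_on unit_disc \<and> w 0 = 0 \<and> (\<forall>z\<in>unit_disc. norm (w z) \<le> norm z) \<and>
          (\<forall>z\<in>unit_disc. f z = g (w z)))"

text \<open>\<open>S_quot j f\<close> is \<open>S\<^sub>j = z\<^sup>j f\<^sup>(\<^sup>j\<^sup>)(z) / f(z)\<close>. The constant \<open>remove_sings\<close> fills in the
  removable singularity at \<open>0\<close>. A zero \<open>z\<^sub>0 \<noteq> 0\<close> of \<open>f\<close> in the disc remains a genuine pole
  of \<open>S\<^sub>1\<close>, so that holomorphy, as required by \<open>(\<prec>\<^sub>s)\<close>, fails there.\<close>
definition S_quot :: "nat \<Rightarrow> (complex \<Rightarrow> complex) \<Rightarrow> complex \<Rightarrow> complex" where
  "S_quot j f = remove_sings (\<lambda>z. z ^ j * (deriv ^^ j) f z / f z)"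

definition starlike_sin :: "(complex \<Rightarrow> complex) set" where
  "starlike_sin = {f \<in> class_A. S_quot 1 f \<prec>\<^sub>s (\<lambda>z. 1 + sin z)}"

definition S_expr :: "real \<Rightarrow> real \<Rightarrow> (complex \<Rightarrow> complex) \<Rightarrow> complex \<Rightarrow> complex" where
  "S_expr \<beta>\<^sub>1 \<beta>\<^sub>2 f z =
     (let S\<^sub>1 = S_quot 1 f z; S\<^sub>2 = S_quot 2 f z; S\<^sub>3 = S_quot 3 f z
      in 1 + of_real \<beta>\<^sub>1 * (S\<^sub>2 - S\<^sub>1\<^sup>2 + S\<^sub>1)
           + of_real \<beta>\<^sub>2 * (S\<^sub>3 + 2 * S\<^sub>2 + 2 * S\<^sub>1 ^ 3 - 2 * S\<^sub>1\<^sup>2 - 3 * S\<^sub>1 * S\<^sub>2))"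

definition \<nu>\<^sub>0 :: real where
  "\<nu>\<^sub>0 = sqrt (1 - (sin 1)\<^sup>2)"

definition \<nu>\<^sub>1 :: real where
  "\<nu>\<^sub>1 = - (sin 2 / (1 + cos 2))"

definition r\<^sub>0 :: real where
  "r\<^sub>0 = (THE r. r > 0 \<and> r\<^sup>2 + 2 * cot 1 * r - 1 = 0)"

lemma r\<^sub>0_well_defined: "\<exists>!r::real. r > 0 \<and> r\<^sup>2 + 2 * cot 1 * r - 1 = 0"
proof (rule ex_ex1I)
  define c :: real where "c = cot 1"
  have "sqrt (c\<^sup>2 + 1) > \<bar>c\<bar>"
    by (rule real_less_rsqrt) simp
  then have "sqrt (c\<^sup>2 + 1) - c > 0"
    by linarith
  moreover have "(sqrt (c\<^sup>2 + 1) - c)\<^sup>2 + 2 * c * (sqrt (c\<^sup>2 + 1) - c) - 1 = 0"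
    by (simp add: power2_diff algebra_simps) (simp add: power2_eq_square)
  ultimately show "\<exists>r::real. r > 0 \<and> r\<^sup>2 + 2 * cot 1 * r - 1 = 0"
    unfolding c_def by blast
next
  fix r s :: real
  assume r: "r > 0 \<and> r\<^sup>2 + 2 * cot 1 * r - 1 = 0" and s: "s > 0 \<and> s\<^sup>2 + 2 * cot 1 * s - 1 = 0"
  have "s * (r\<^sup>2 + 2 * cot 1 * r - 1) - r * (s\<^sup>2 + 2 * cot 1 * s - 1) = (r - s) * (r * s + 1)"
    by (simp add: power2_eq_square algebra_simps)
  then have "(r - s) * (r * s + 1) = 0"
    using r s by simp
  moreover have "r * s + 1 > 0"
    using r s by (simp add: add_pos_pos)
  ultimately show "r = s"
    by simp
qed

text \<open>The library's complex \<open>arsinh\<close> is the principal branch of \<open>sinh\<^sup>-\<^sup>1\<close>.\<close>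
lemma arsinh_complex: "arsinh z = Ln (z + csqrt (1 + z\<^sup>2))" for z :: complex
  by (simp add: arsinh_def csqrt_conv_powr add.commute)

end

theory Submission
  imports Defs
begin

text \<open>
  With \<open>p = S\<^sub>1\<close> one has \<open>S\<^sub>2 - S\<^sub>1\<^sup>2 + S\<^sub>1 = z p'\<close>, and the factor of \<open>\<beta>\<^sub>2\<close> is \<open>z\<^sup>2 p''\<close>.
  So \<open>S\<^sub>f\<close> determines \<open>u = p'\<close> through the linear equation
  \<open>\<beta>\<^sub>1 u + \<beta>\<^sub>2 z u' = (S\<^sub>f - 1) / z\<close>. If \<open>\<bar>S\<^sub>f - 1\<bar> < K\<close>, the right-hand side is at most \<open>K\<close> by
  Schwarz' lemma, hence \<open>\<bar>u\<bar> \<le> K / \<beta>\<^sub>1\<close> and \<open>\<bar>p(z) - 1\<bar> \<le> (K / \<beta>\<^sub>1) \<bar>z\<bar>\<close>. As \<open>\<nu>\<^sub>1 < 0\<close>,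
  \<open>\<nu>\<^sub>0 = cos 1\<close> and \<open>cos 1 \<le> (2/3) sin 1\<close>, each condition gives \<open>K \<le> \<beta>\<^sub>1 sin 1\<close>, and the disc of
  radius \<open>sin 1\<close> about \<open>0\<close> lies in the image of the unit disc under \<open>sin\<close>.

  Only \<open>S\<^sub>f\<close> is assumed to be holomorphic, so a priori \<open>p\<close> exists near \<open>0\<close> only. But the equation
  has a solution \<open>u\<close> on the whole disc; it extends \<open>p\<close> to \<open>P\<close> with \<open>z f' = P f\<close>, and therefore
  \<open>f\<close> has no zero besides \<open>0\<close>.
\<close>


section \<open>The equation a u + b z u' = h on a disc about 0\<close>

text \<open>\<open>t\<^sup>1\<^sup>-\<^sup>\<alpha>\<close> times the derivative of \<open>t\<^sup>\<alpha> u(t z)\<close>, where \<open>\<alpha> = a / b\<close>, is \<open>1 / b\<close> times the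
  left-hand side of the equation at \<open>t z\<close>.\<close>
lemma ode_solution_bound:
  fixes a b K r :: real and u :: "complex \<Rightarrow> complex"
  assumes "a > 0" "b > 0" and u: "u holomorphic_on ball 0 r"
    and bound: "\<And>z. z \<in> ball 0 r \<Longrightarrow> norm (of_real a * u z + of_real b * z * deriv u z) \<le> K"
    and z: "z \<in> ball 0 r"
  shows "norm (u z) \<le> K / a"
proof -
  define \<alpha> where "\<alpha> = a / b"
  have \<alpha>: "\<alpha> > 0" using assms by (simp add: \<alpha>_def)
  define \<phi> where "\<phi> = (\<lambda>t::real. complex_of_real (t powr \<alpha>) * u (of_real t * z))"
  have tz: "of_real t * z \<in> ball 0 r" if "0 \<le> t" "t \<le> 1" for t :: real
  proof -
    have "t * norm z \<le> 1 * norm z"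
      using that by (intro mult_right_mono) auto
    then show ?thesis using z that by (simp add: norm_mult)
  qed
  \<comment> \<open>Mean value inequality with majorant \<open>K / a * t powr \<alpha>\<close>.
    Derivatives are taken on the open interval only, as \<open>t powr (\<alpha> - 1)\<close> may
    blow up at 0. Both functions vanish at 0 because \<open>0 powr \<alpha> = 0\<close>, and
    \<open>\<phi> 1\<close> is \<open>u z\<close>.\<close>
  have "norm (\<phi> 1 - \<phi> 0) \<le> K / a * 1 powr \<alpha> - K / a * 0 powr \<alpha>"
  proof (rule differentiable_bound_general)
    have "continuous_on {0..1} (\<lambda>t. u (complex_of_real t * z))"
      by (rule continuous_on_compose2[OF holomorphic_on_imp_continuous_on[OF u]])
        (auto intro!: continuous_intros tz simp del: mem_ball)
    then show "continuous_on {0..1} \<phi>"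
      unfolding \<phi>_def using \<alpha> by (intro continuous_intros continuous_on_powr') auto
    show "continuous_on {0..1} (\<lambda>t. K / a * t powr \<alpha>)"
      using \<alpha> by (intro continuous_intros continuous_on_powr') auto
    fix t :: real assume t: "0 < t" "t < 1"
    have "(u has_field_derivative deriv u (of_real t * z)) (at (of_real t * z))"
      by (rule holomorphic_derivI[OF u]) (use t tz[of t] in auto)
    then have "((\<lambda>w. u (w * z)) has_field_derivative deriv u (of_real t * z) * z) (at (of_real t))"
      by (rule DERIV_chain2) (auto intro!: derivative_eq_intros)
    then have "((\<lambda>s. u (of_real s * z)) has_vector_derivative deriv u (of_real t * z) * z) (at t)"
      by (rule has_vector_derivative_real_field)
    moreover have "((\<lambda>s. s powr \<alpha>) has_field_derivative \<alpha> * t powr (\<alpha> - 1)) (at t)"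
      using has_real_derivative_powr[OF t(1)] by blast
    then have "((\<lambda>s. of_real (s powr \<alpha>)) has_vector_derivative complex_of_real (\<alpha> * t powr (\<alpha> - 1))) (at t)"
      by (intro has_vector_derivative_of_real) (simp add: has_real_derivative_iff_has_vector_derivative)
    ultimately show "(\<phi> has_vector_derivative
        (of_real (t powr \<alpha>) * (deriv u (of_real t * z) * z)
          + of_real (\<alpha> * t powr (\<alpha> - 1)) * u (of_real t * z))) (at t)"
      unfolding \<phi>_def by (rule has_vector_derivative_mult[rotated])
    show "((\<lambda>t. K / a * t powr \<alpha>) has_vector_derivative K / a * (\<alpha> * t powr (\<alpha> - 1))) (at t)"
      using t unfolding has_real_derivative_iff_has_vector_derivative[symmetric]
      by (intro DERIV_cmult has_real_derivative_powr)
    define c where "c = t powr (\<alpha> - 1)"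
    have pw: "t powr \<alpha> = t * t powr (\<alpha> - 1)"
      using t by (simp add: powr_mult_base)
    have "of_real (t powr \<alpha>) * (deriv u (of_real t * z) * z)
          + of_real (\<alpha> * t powr (\<alpha> - 1)) * u (of_real t * z)
        = of_real (t powr (\<alpha> - 1) / b) *
          (of_real a * u (of_real t * z) + of_real b * (of_real t * z) * deriv u (of_real t * z))"
      unfolding pw c_def[symmetric] unfolding \<alpha>_def using \<open>b > 0\<close> by (simp add: field_simps)
    then have "norm (of_real (t powr \<alpha>) * (deriv u (of_real t * z) * z)
          + of_real (\<alpha> * t powr (\<alpha> - 1)) * u (of_real t * z))
        = t powr (\<alpha> - 1) / b *
          norm (of_real a * u (of_real t * z) + of_real b * (of_real t * z) * deriv u (of_real t * z))"
      using \<open>b > 0\<close> by (simp only: norm_mult norm_of_real) simp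
    also have "\<dots> \<le> t powr (\<alpha> - 1) / b * K"
      by (intro mult_left_mono bound tz) (use t \<open>b > 0\<close> in auto)
    also have "\<dots> = K / a * (\<alpha> * t powr (\<alpha> - 1))"
      using assms by (simp add: \<alpha>_def field_simps)
    finally show "norm (of_real (t powr \<alpha>) * (deriv u (of_real t * z) * z)
          + of_real (\<alpha> * t powr (\<alpha> - 1)) * u (of_real t * z))
        \<le> K / a * (\<alpha> * t powr (\<alpha> - 1))" .
  qed simp
  then show ?thesis using \<alpha> by (simp add: \<phi>_def)
qed

text \<open>Comparison of power series coefficients: z u' multiplies the n-th coefficient by n, so
  the n-th coefficient of h has to be divided by a + b n. As this is at least a > 0, the series
  still converges on the unit disc.\<close>

lemma ode_solution_exists:
  fixes a b :: real and h :: "complex \<Rightarrow> complex"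
  assumes "a > 0" "b > 0" and h: "h holomorphic_on ball 0 1"
  obtains u where "u holomorphic_on ball 0 1"
    "\<And>z. z \<in> ball 0 1 \<Longrightarrow> of_real a * u z + of_real b * z * deriv u z = h z"
proof -
  define F where "F = fps_expansion h 0"
  define G where "G = Abs_fps (\<lambda>n. fps_nth F n / of_real (a + b * of_nat n))"
  have eb: "eball 0 1 = (ball 0 1 :: complex set)"
    unfolding one_ereal_def by (rule eball_ereal)
  have F: "fps_conv_radius F \<ge> 1"
    unfolding F_def by (rule conv_radius_fps_expansion) (simp add: eb h)
  have G: "fps_conv_radius G \<ge> 1"
    unfolding fps_conv_radius_def
  proof (rule conv_radius_geI_ex')
    fix r :: real assume r: "0 < r" "ereal r < 1"
    have "summable (\<lambda>n. norm (fps_nth F n * of_real r ^ n))"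
      using r less_le_trans[OF r(2) F] by (intro abs_summable_in_conv_radius) (simp add: fps_conv_radius_def)
    then have "summable (\<lambda>n. norm (fps_nth F n * of_real r ^ n) / a)"
      by (rule summable_divide)
    then show "summable (\<lambda>n. fps_nth G n * of_real r ^ n)"
    proof (rule summable_comparison_test'[where N = 0])
      fix n :: nat
      have "norm (fps_nth F n * of_real r ^ n) / (a + b * real n) \<le> norm (fps_nth F n * of_real r ^ n) / a"
        using assms by (intro divide_left_mono mult_pos_pos add_pos_nonneg) auto
      moreover have "norm (complex_of_real (a + b * real n)) = a + b * real n"
        using assms by (subst norm_of_real) (simp add: add_pos_nonneg)
      ultimately show "norm (fps_nth G n * of_real r ^ n) \<le> norm (fps_nth F n * of_real r ^ n) / a"
        unfolding G_def by (simp add: norm_mult norm_divide del: of_real_add of_real_mult)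
    qed
  qed
  have GF: "fps_const (of_real a) * G + fps_const (of_real b) * (fps_X * fps_deriv G) = F"
  proof (rule fps_ext)
    fix n
    have "a + b * real n > 0" using assms by (simp add: add_pos_nonneg)
    then have "complex_of_real (a + b * real n) \<noteq> 0"
      by (metis of_real_eq_0_iff less_irrefl)
    then have "of_real (a + b * real n) * fps_nth G n = fps_nth F n"
      by (simp add: G_def)
    then show "fps_nth (fps_const (of_real a) * G + fps_const (of_real b) * (fps_X * fps_deriv G)) n = fps_nth F n"
      by (cases n) (simp_all add: algebra_simps)
  qed
  show ?thesis
  proof
    show "eval_fps G holomorphic_on ball 0 1"
      using eball_mono[OF G, of "0 :: complex"] by (intro holomorphic_on_eval_fps) (simp only: eb)
    fix z :: complex assume z: "z \<in> ball 0 1"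
    then have z1: "ereal (norm z) < 1" by (simp add: one_ereal_def)
    then have zG: "norm z < fps_conv_radius G" using G by (rule less_le_trans)
    then have zG': "norm z < fps_conv_radius (fps_deriv G)"
      using fps_conv_radius_deriv by (rule less_le_trans)
    have zX: "norm z < fps_conv_radius (fps_X * fps_deriv G)"
      by (rule less_le_trans[OF _ fps_conv_radius_mult]) (simp add: zG')
    have c: "norm z < fps_conv_radius (fps_const c * H)" if "norm z < fps_conv_radius H" for c and H :: "complex fps"
      by (rule less_le_trans[OF _ fps_conv_radius_mult]) (simp add: that)
    have "eval_fps F z = of_real a * eval_fps G z + of_real b * (z * eval_fps (fps_deriv G) z)"
      by (simp flip: GF add: eval_fps_add eval_fps_mult c zX zG zG')
    moreover have "eval_fps (fps_deriv G) z = deriv (eval_fps G) z"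
      by (rule eval_fps_deriv) (rule zG)
    moreover have "eval_fps F z = h z"
      unfolding F_def using eval_fps_expansion'[of h 0 1 z] h z1 by (simp add: eb)
    ultimately show "of_real a * eval_fps G z + of_real b * z * deriv (eval_fps G) z = h z"
      by simp
  qed
qed

section \<open>The logarithmic derivative of f and its continuation to the disc\<close>

text \<open>With X = f'/f and Y = f''/f one has p = z X, X' = Y - X^2 and Y' = f'''/f - X Y.
  Differentiating p twice by these rules gives both identities.\<close>

lemma log_derivative_derivs:
  fixes f p :: "complex \<Rightarrow> complex"
  assumes "open A" and f: "f holomorphic_on A" and nz: "\<And>z. z \<in> A \<Longrightarrow> f z \<noteq> 0"
    and p: "\<And>z. z \<in> A \<Longrightarrow> p z = z * deriv f z / f z" and z: "z \<in> A"
  defines "S \<equiv> (\<lambda>j z. z ^ j * (deriv ^^ j) f z / f z)"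
  shows "z * deriv p z = S 2 z - (S 1 z)\<^sup>2 + S 1 z"
    and "z\<^sup>2 * deriv (deriv p) z
      = S 3 z + 2 * S 2 z + 2 * S 1 z ^ 3 - 2 * (S 1 z)\<^sup>2 - 3 * S 1 z * S 2 z"
proof -
  define f1 f2 f3 where "f1 = deriv f" "f2 = deriv f1" "f3 = deriv f2"
  note fd = f1_f2_f3_def
  have h1: "f1 holomorphic_on A" unfolding fd using f \<open>open A\<close> by (rule holomorphic_deriv)
  have h2: "f2 holomorphic_on A" unfolding fd(2) using h1 \<open>open A\<close> by (rule holomorphic_deriv)
  have d0: "(f has_field_derivative f1 w) (at w)" if "w \<in> A" for w
    using holomorphic_derivI[OF f \<open>open A\<close> that] by (simp add: fd)
  have d1: "(f1 has_field_derivative f2 w) (at w)" if "w \<in> A" for w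
    using holomorphic_derivI[OF h1 \<open>open A\<close> that] by (simp add: fd(2))
  have d2: "(f2 has_field_derivative f3 w) (at w)" if "w \<in> A" for w
    using holomorphic_derivI[OF h2 \<open>open A\<close> that] by (simp add: fd(3))
  define X Y where "X = (\<lambda>z. f1 z / f z)" and "Y = (\<lambda>z. f2 z / f z)"
  have dX: "(X has_field_derivative Y w - (X w)\<^sup>2) (at w)" if w: "w \<in> A" for w
    unfolding X_def Y_def using DERIV_divide[OF d1[OF w] d0[OF w] nz[OF w]] nz[OF w]
    by (simp add: field_simps power2_eq_square)
  have dY: "(Y has_field_derivative f3 w / f w - X w * Y w) (at w)" if w: "w \<in> A" for w
    unfolding X_def Y_def using DERIV_divide[OF d2[OF w] d0[OF w] nz[OF w]] nz[OF w]
    by (simp add: field_simps)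
  have S: "S 1 z = z * X z" "S 2 z = z\<^sup>2 * Y z" "S 3 z = z ^ 3 * (f3 z / f z)" for z
    by (simp_all add: S_def X_def Y_def fd eval_nat_numeral)
  have dp: "deriv p w = X w + w * (Y w - (X w)\<^sup>2)" if w: "w \<in> A" for w
  proof -
    have "((\<lambda>z. z * X z) has_field_derivative X w + w * (Y w - (X w)\<^sup>2)) (at w)"
      by (rule derivative_eq_intros dX[OF w] refl | simp)+
    then have "(p has_field_derivative X w + w * (Y w - (X w)\<^sup>2)) (at w)"
      by (rule has_field_derivative_transform_within_open[OF _ \<open>open A\<close> w]) (simp add: p fd X_def)
    then show ?thesis by (rule DERIV_imp_deriv)
  qed
  show "z * deriv p z = S 2 z - (S 1 z)\<^sup>2 + S 1 z"
    unfolding S dp[OF z] by algebra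
  define q where "q = (Y z - (X z)\<^sup>2) + ((Y z - (X z)\<^sup>2)
    + z * (f3 z / f z - X z * Y z - 2 * X z * (Y z - (X z)\<^sup>2)))"
  have "((\<lambda>w. X w + w * (Y w - (X w)\<^sup>2)) has_field_derivative q) (at z)"
    by (rule derivative_eq_intros dX[OF z] dY[OF z] refl)+ (simp add: q_def)
  then have "(deriv p has_field_derivative q) (at z)"
    by (rule has_field_derivative_transform_within_open[OF _ \<open>open A\<close> z]) (simp add: dp)
  then have dq: "deriv (deriv p) z = q" by (rule DERIV_imp_deriv)
  show "z\<^sup>2 * deriv (deriv p) z
      = S 3 z + 2 * S 2 z + 2 * S 1 z ^ 3 - 2 * (S 1 z)\<^sup>2 - 3 * S 1 z * S 2 z"
    unfolding S dq q_def by algebra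
qed

text \<open>Schwarz' lemma for (S - 1) / K, which fixes 0 and maps the disc into itself. Its
  quotient by z is filled in at 0 by the derivative, which the lemma bounds as well.\<close>

lemma Schwarz_quotient:
  fixes S :: "complex \<Rightarrow> complex"
  assumes S: "S holomorphic_on unit_disc" "S 0 = 1"
    and bound: "\<And>z. z \<in> unit_disc \<Longrightarrow> norm (S z - 1) < K"
  obtains h where "h holomorphic_on unit_disc" "\<And>z. z \<in> unit_disc \<Longrightarrow> S z = 1 + z * h z"
    "\<And>z. z \<in> unit_disc \<Longrightarrow> norm (h z) \<le> K"
proof
  have K: "K > 0" using bound[of 0] S by simp
  define T where "T = (\<lambda>z. (S z - 1) / of_real K)"
  have T: "T holomorphic_on unit_disc" "T 0 = 0"
    unfolding T_def using K S by (auto intro!: holomorphic_intros)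
  have T1: "norm (T z) < 1" if "norm z < 1" for z
    using bound[of z] that K by (simp add: T_def norm_divide)
  define q where "q = (\<lambda>z. if z = 0 then deriv T 0 else (T z - T 0) / (z - 0))"
  have q: "q holomorphic_on unit_disc"
    unfolding q_def by (rule pole_lemma_open) (use T in auto)
  then show "(\<lambda>z. of_real K * q z) holomorphic_on unit_disc"
    by (intro holomorphic_intros)
  show "S z = 1 + z * (of_real K * q z)" for z
    using K S T(2) by (simp add: q_def T_def)
  fix z :: complex assume z: "z \<in> unit_disc"
  have "norm (q z) \<le> 1"
  proof (cases "z = 0")
    case True
    then show ?thesis using Schwarz_Lemma(2)[OF T T1, of 0] by (simp add: q_def)
  next
    case False
    then show ?thesis using Schwarz_Lemma(1)[OF T T1, of z] z T(2)
      by (simp add: q_def norm_divide)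
  qed
  then show "norm (of_real K * q z) \<le> K"
    using K mult_left_mono[of "norm (q z)" 1 K] by (simp add: norm_mult)
qed

lemma S_quot_eq:
  assumes "f holomorphic_on A" "open A" "z \<in> A" "f z \<noteq> 0"
  shows "S_quot j f z = z ^ j * (deriv ^^ j) f z / f z"
proof -
  have "f analytic_on {z}"
    using assms by (metis analytic_on_open analytic_on_subset empty_subsetI insert_subset)
  then have "(\<lambda>z. z ^ j * (deriv ^^ j) f z / f z) analytic_on {z}"
    using assms(4) by (auto intro!: analytic_intros)
  then show ?thesis unfolding S_quot_def by (rule remove_sings_at_analytic)
qed

lemma class_A_imp_eq_times:
  assumes "f \<in> class_A"
  obtains k where "k holomorphic_on unit_disc" "k 0 = 1" "\<And>z. f z = z * k z"
proof
  define k where "k = (\<lambda>z. if z = 0 then deriv f 0 else (f z - f 0) / (z - 0))"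
  show "k holomorphic_on unit_disc"
    unfolding k_def by (rule pole_lemma_open) (use assms in \<open>auto simp: class_A_def\<close>)
  show "k 0 = 1" "f z = z * k z" for z
    using assms by (auto simp: k_def class_A_def)
qed

text \<open>Near 0 write f(z) = z k(z) with k zero-free, so p = z f'/f = 1 + z k'/k is holomorphic
  there. Both p' and u solve the linear equation with right-hand side h, hence agree, and p(0) =
  P(0) = 1 gives p = P. The conclusion avoids division so that it can be continued to the whole
  disc.\<close>

lemma log_derivative_ode_near_0:
  assumes f: "f \<in> class_A" and "\<beta>\<^sub>1 > 0" "\<beta>\<^sub>2 > 0"
    and h: "h holomorphic_on unit_disc" "\<And>z. z \<in> unit_disc \<Longrightarrow> S_expr \<beta>\<^sub>1 \<beta>\<^sub>2 f z = 1 + z * h z"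
    and u: "u holomorphic_on unit_disc"
    and ode: "\<And>z. z \<in> unit_disc \<Longrightarrow> of_real \<beta>\<^sub>1 * u z + of_real \<beta>\<^sub>2 * z * deriv u z = h z"
    and P: "\<And>z. z \<in> unit_disc \<Longrightarrow> (P has_field_derivative u z) (at z)" "P 0 = 1"
  obtains r where "r > 0" "r \<le> 1" "\<And>z. z \<in> ball 0 r \<Longrightarrow> z * deriv f z = P z * f z"
proof -
  obtain k where k: "k holomorphic_on unit_disc" "k 0 = 1" and fk: "\<And>z. f z = z * k z"
    using class_A_imp_eq_times[OF f] by blast
  have fh: "f holomorphic_on unit_disc" using f by (simp add: class_A_def)
  have "continuous_on unit_disc k" using k by (simp add: holomorphic_on_imp_continuous_on)
  then have "isCont k 0" by (simp add: continuous_on_eq_continuous_at)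
  then have "\<forall>\<^sub>F z in nhds 0. k z \<noteq> 0"
    using k(2) by (intro tendsto_imp_eventually_ne[of _ 1]) (auto simp: isCont_def tendsto_nhds_iff)
  then obtain e where e: "e > 0" "\<And>z. dist z 0 < e \<Longrightarrow> k z \<noteq> 0"
    by (auto simp: eventually_nhds_metric)
  define r where "r = min e 1"
  have r: "r > 0" "r \<le> 1" using e by (auto simp: r_def)
  have sub: "ball 0 r \<subseteq> unit_disc" using r by auto
  have knz: "k z \<noteq> 0" if "z \<in> ball 0 r" for z
    using that by (intro e) (auto simp: r_def)
  define p where "p = (\<lambda>z. 1 + z * deriv k z / k z)"
  have p: "p holomorphic_on ball 0 r"
    unfolding p_def using knz holomorphic_on_subset[OF k(1) sub]
    by (intro holomorphic_intros) auto
  have df: "deriv f z = k z + z * deriv k z" if "z \<in> ball 0 r" for z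
  proof (rule DERIV_imp_deriv)
    have "z \<in> unit_disc" using that sub by blast
    then have "((\<lambda>z. z * k z) has_field_derivative k z + z * deriv k z) (at z)"
      by (auto intro!: derivative_eq_intros holomorphic_derivI[OF k(1)])
    then show "(f has_field_derivative k z + z * deriv k z) (at z)"
      by (simp add: fk[abs_def])
  qed
  have dp: "deriv p holomorphic_on ball 0 r"
    using p by (intro holomorphic_deriv) auto
  have uh: "u holomorphic_on ball 0 r" using u sub by (rule holomorphic_on_subset)
  define d where "d = (\<lambda>z. deriv p z - u z)"
  have d: "d holomorphic_on ball 0 r" unfolding d_def by (intro holomorphic_intros dp uh)
  have dd: "deriv d holomorphic_on ball 0 r" using d by (intro holomorphic_deriv) auto
  \<comment> \<open>The left-hand side of the equation applied to the difference of p' and u; it is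
    to vanish identically.\<close>
  define E where "E = (\<lambda>z. of_real \<beta>\<^sub>1 * d z + of_real \<beta>\<^sub>2 * z * deriv d z)"
  have E: "E holomorphic_on ball 0 r"
    unfolding E_def by (intro holomorphic_intros d dd)
  have E0: "E z = 0" if z: "z \<in> ball 0 r - {0}" for z
  proof -
    let ?A = "ball 0 r - {0 :: complex}"
    have o: "open ?A" by auto
    have fA: "f holomorphic_on ?A" using fh sub by (auto intro: holomorphic_on_subset)
    have nz: "f w \<noteq> 0" if "w \<in> ?A" for w using that knz by (simp add: fk)
    have pA: "p w = w * deriv f w / f w" if "w \<in> ?A" for w
      using that knz[of w] df[of w] by (simp add: p_def fk field_simps)
    have zu: "z \<in> unit_disc" using z sub by blast
    define T where "T = (\<lambda>j. z ^ j * (deriv ^^ j) f z / f z)"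
    have L: "z * deriv p z = T 2 - (T 1)\<^sup>2 + T 1"
      "z\<^sup>2 * deriv (deriv p) z = T 3 + 2 * T 2 + 2 * T 1 ^ 3 - 2 * (T 1)\<^sup>2 - 3 * T 1 * T 2"
      unfolding T_def by (rule log_derivative_derivs[OF o fA nz pA z]; assumption)+
    have "S_quot j f z = T j" for j
      unfolding T_def by (rule S_quot_eq[OF fA o z nz[OF z]])
    then have "z * h z = of_real \<beta>\<^sub>1 * (z * deriv p z) + of_real \<beta>\<^sub>2 * (z\<^sup>2 * deriv (deriv p) z)"
      using h(2)[OF zu] unfolding L S_expr_def Let_def
      by (simp only: add.assoc add_left_cancel)
    then have "z * (of_real \<beta>\<^sub>1 * u z + of_real \<beta>\<^sub>2 * z * deriv u z)
        = z * (of_real \<beta>\<^sub>1 * deriv p z + of_real \<beta>\<^sub>2 * z * deriv (deriv p) z)"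
      using ode[OF zu] by (simp add: algebra_simps power2_eq_square)
    moreover have dd: "deriv d z = deriv (deriv p) z - deriv u z"
      unfolding d_def using z dp uh
      by (intro deriv_diff) (auto intro: holomorphic_on_imp_differentiable_at[where s = "ball 0 r"])
    ultimately have "z * E z = 0"
      unfolding E_def dd by (simp add: d_def algebra_simps)
    then show ?thesis using z by simp
  qed
  \<comment> \<open>The quotients by f exclude the point 0; the identity theorem fills it
    in.\<close>
  have E0': "E z = 0" if "z \<in> ball 0 r" for z
  proof (rule analytic_continuation_open[where s = "ball 0 r - {0}" and s' = "ball 0 r"
        and f = E and g = "\<lambda>_. 0"])
    have "of_real (r / 2) \<in> ball 0 r - {0 :: complex}" using r by simp
    then show "ball 0 r - {0 :: complex} \<noteq> {}" by blast
  qed (use E E0 that in auto)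
  \<comment> \<open>Uniqueness for the homogeneous equation: the bound
    \<open>ode_solution_bound\<close> with right-hand side at most 0.\<close>
  have d0: "d z = 0" if "z \<in> ball 0 r" for z
    using ode_solution_bound[OF \<open>\<beta>\<^sub>1 > 0\<close> \<open>\<beta>\<^sub>2 > 0\<close> d, of 0 z] E0' that by (simp add: E_def)
  have "\<exists>c. \<forall>z\<in>ball 0 r. p z - P z = c"
  proof (rule has_field_derivative_zero_constant)
    fix z :: complex assume z: "z \<in> ball 0 r"
    have "(p has_field_derivative deriv p z) (at z)"
      using p z by (intro holomorphic_derivI) auto
    then have "((\<lambda>z. p z - P z) has_field_derivative deriv p z - u z) (at z)"
      using z sub by (intro DERIV_diff P(1)) auto
    then show "((\<lambda>z. p z - P z) has_field_derivative 0) (at z within ball 0 r)"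
      using d0[OF z] by (simp add: d_def has_field_derivative_at_within)
  qed auto
  moreover have "p 0 - P 0 = 0" by (simp add: p_def P)
  ultimately have pP: "p z = P z" if "z \<in> ball 0 r" for z
    using r that by (metis centre_in_ball eq_iff_diff_eq_0)
  have "z * deriv f z = P z * f z" if z: "z \<in> ball 0 r" for z
    using pP[OF z] df[OF z] knz[OF z] by (simp add: p_def fk field_simps)
  with r that show ?thesis by blast
qed

text \<open>For k = f/z and \<phi> = (P - 1)/z, the equation z f' = P f becomes k' = \<phi> k. So k
  is a constant times the exponential of a primitive of \<phi>, and k(0) = 1 makes the constant
  nonzero.\<close>

lemma log_derivative_ode_imp_nonzero:
  assumes f: "f \<in> class_A" and P: "P holomorphic_on unit_disc" "P 0 = 1"
    and ode: "\<And>z. z \<in> unit_disc \<Longrightarrow> z * deriv f z = P z * f z"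
    and z: "z \<in> unit_disc" "z \<noteq> 0"
  shows "f z \<noteq> 0"
proof -
  obtain k where k: "k holomorphic_on unit_disc" "k 0 = 1" and fk: "\<And>z. f z = z * k z"
    using class_A_imp_eq_times[OF f] by blast
  have kd: "(k has_field_derivative deriv k w) (at w)" if "w \<in> unit_disc" for w
    using holomorphic_derivI[OF k(1) _ that] by simp
  define \<phi> where "\<phi> = (\<lambda>z. if z = 0 then deriv P 0 else (P z - P 0) / (z - 0))"
  have "\<phi> holomorphic_on unit_disc"
    unfolding \<phi>_def by (rule pole_lemma_open) (use P in auto)
  then obtain \<Phi> where \<Phi>: "\<And>w. w \<in> unit_disc \<Longrightarrow> (\<Phi> has_field_derivative \<phi> w) (at w within unit_disc)"
    using holomorphic_convex_primitive'[of unit_disc \<phi>] by auto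
  define F where "F = (\<lambda>z. k z * exp (- \<Phi> z))"
  have F: "(F has_field_derivative (deriv k w - \<phi> w * k w) * exp (- \<Phi> w)) (at w)"
    if w: "w \<in> unit_disc" for w
    unfolding F_def using \<Phi>[OF w] kd[OF w] at_within_open[OF w]
    by (auto intro!: derivative_eq_intros simp: algebra_simps)
  have "F constant_on unit_disc"
  \<comment> \<open>Reaching k' = \<phi> k takes a division by w^2, so the derivative of
    \<open>F\<close> is shown to vanish off 0 only; one exceptional point is harmless for a
    continuous function.\<close>
  proof (rule DERIV_zero_connected_constant_on[where K = "{0}"])
    show "continuous_on unit_disc F"
      by (intro continuous_at_imp_continuous_on) (blast intro: DERIV_isCont F)
    show "\<forall>w\<in>unit_disc - {0}. (F has_field_derivative 0) (at w)"
    proof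
      fix w :: complex assume w: "w \<in> unit_disc - {0}"
      then have "deriv f w = k w + w * deriv k w"
        by (intro DERIV_imp_deriv) (auto simp: fk[abs_def] intro!: derivative_eq_intros kd)
      with w ode[of w] have "w * (w * (deriv k w - \<phi> w * k w)) = 0"
        by (simp add: fk \<phi>_def P field_simps)
      with w have "deriv k w - \<phi> w * k w = 0" by simp
      then show "(F has_field_derivative 0) (at w)" using F[of w] w by simp
    qed
  qed auto
  then obtain c where c: "\<And>w. w \<in> unit_disc \<Longrightarrow> F w = c" unfolding constant_on_def by blast
  have "F 0 \<noteq> 0" using k by (simp add: F_def)
  then have "F z \<noteq> 0" using c z by (metis centre_in_ball zero_less_one)
  then show ?thesis using z by (simp add: F_def fk)
qed

lemma S_quot_1_deviation:
  assumes f: "f \<in> class_A" and \<beta>: "\<beta>\<^sub>1 > 0" "\<beta>\<^sub>2 > 0"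
    and S: "S_expr \<beta>\<^sub>1 \<beta>\<^sub>2 f holomorphic_on unit_disc" "S_expr \<beta>\<^sub>1 \<beta>\<^sub>2 f 0 = 1"
    and bound: "\<And>z. z \<in> unit_disc \<Longrightarrow> norm (S_expr \<beta>\<^sub>1 \<beta>\<^sub>2 f z - 1) < K"
  shows "S_quot 1 f holomorphic_on unit_disc" "S_quot 1 f 0 = 1"
    and "\<And>z. z \<in> unit_disc \<Longrightarrow> norm (S_quot 1 f z - 1) \<le> K / \<beta>\<^sub>1 * norm z"
proof -
  obtain h where h: "h holomorphic_on unit_disc"
      "\<And>z. z \<in> unit_disc \<Longrightarrow> S_expr \<beta>\<^sub>1 \<beta>\<^sub>2 f z = 1 + z * h z"
    and hK: "\<And>z. z \<in> unit_disc \<Longrightarrow> norm (h z) \<le> K"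
    using Schwarz_quotient[OF S bound] by blast
  obtain u where u: "u holomorphic_on unit_disc"
    and ode: "\<And>z. z \<in> unit_disc \<Longrightarrow> of_real \<beta>\<^sub>1 * u z + of_real \<beta>\<^sub>2 * z * deriv u z = h z"
    using ode_solution_exists[OF \<beta> h(1)] by blast
  have uK: "norm (u z) \<le> K / \<beta>\<^sub>1" if "z \<in> unit_disc" for z
    using ode_solution_bound[OF \<beta> u, of K z] ode hK that by simp
  obtain Q where Q: "\<And>w. w \<in> unit_disc \<Longrightarrow> (Q has_field_derivative u w) (at w within unit_disc)"
    using holomorphic_convex_primitive'[of unit_disc u] u by auto
  define P where "P = (\<lambda>z. Q z - Q 0 + 1)"
  have Pd: "(P has_field_derivative u w) (at w)" if w: "w \<in> unit_disc" for w
    unfolding P_def using Q[OF w] at_within_open[OF w] by (auto intro!: derivative_eq_intros)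
  have P0: "P 0 = 1" by (simp add: P_def)
  have Ph: "P holomorphic_on unit_disc"
    using Pd holomorphic_on_open[OF open_ball] by blast
  have fh: "f holomorphic_on unit_disc" using f by (simp add: class_A_def)
  obtain r where r: "r > 0" "r \<le> 1" and near: "\<And>z. z \<in> ball 0 r \<Longrightarrow> z * deriv f z = P z * f z"
    using log_derivative_ode_near_0[OF f \<beta> h u ode Pd P0] by blast
  \<comment> \<open>Both sides are holomorphic on the whole disc, whatever the zeros of f, so the
    local identity extends.\<close>
  have fP: "z * deriv f z = P z * f z" if "z \<in> unit_disc" for z
  proof (rule analytic_continuation_open[where s = "ball 0 r" and s' = unit_disc
        and f = "\<lambda>z. z * deriv f z" and g = "\<lambda>z. P z * f z"])
    show "(\<lambda>z. z * deriv f z) holomorphic_on unit_disc" "(\<lambda>z. P z * f z) holomorphic_on unit_disc"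
      using fh Ph by (auto intro!: holomorphic_intros)
  qed (use r near that in auto)
  have SP: "S_quot 1 f z = P z" if z: "z \<in> unit_disc" "z \<noteq> 0" for z
  proof -
    have nz: "f z \<noteq> 0" by (rule log_derivative_ode_imp_nonzero[OF f Ph P0 fP z])
    show ?thesis
      using fP[OF z(1)] nz by (simp add: S_quot_eq[OF fh open_ball z(1) nz])
  qed
  \<comment> \<open>Since f(0) = 0, the quotient formula says nothing at 0; there
    \<open>remove_sings\<close> takes the limit of the quotient.\<close>
  have SP0: "S_quot 1 f 0 = P 0"
    unfolding S_quot_def
  proof (rule remove_sings_eqI)
    have "P \<midarrow>0\<rightarrow> P 0"
      using DERIV_isCont[OF Pd[of 0]] by (simp add: isCont_def)
    then show "(\<lambda>z. z ^ 1 * (deriv ^^ 1) f z / f z) \<midarrow>0\<rightarrow> P 0"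
    proof (rule Lim_transform_within_open[where s = unit_disc])
      fix z :: complex assume z: "z \<in> unit_disc" "z \<noteq> 0"
      have nz: "f z \<noteq> 0" by (rule log_derivative_ode_imp_nonzero[OF f Ph P0 fP z])
      show "P z = z ^ 1 * (deriv ^^ 1) f z / f z"
        using fP[OF z(1)] nz by simp
    qed auto
  qed
  have eq: "S_quot 1 f z = P z" if "z \<in> unit_disc" for z
    using SP SP0 that by metis
  show "S_quot 1 f holomorphic_on unit_disc"
    by (rule holomorphic_transform[OF Ph]) (simp only: eq)
  show "S_quot 1 f 0 = 1" using SP0 P0 by simp
  show "norm (S_quot 1 f z - 1) \<le> K / \<beta>\<^sub>1 * norm z" if z: "z \<in> unit_disc" for z
  proof -
    \<comment> \<open>Mean value inequality on the convex disc, with P' = u bounded by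
      \<open>K / \<beta>\<^sub>1\<close>.\<close>
    have "norm (P z - P 0) \<le> K / \<beta>\<^sub>1 * norm (z - 0)"
      by (rule field_differentiable_bound[where S = unit_disc and f' = u])
        (use z uK Pd in \<open>auto intro: has_field_derivative_at_within\<close>)
    then show ?thesis using eq[OF z] P0 by simp
  qed
qed

section \<open>The disc of radius sin 1 inside the image of the unit disc under sin\<close>

text \<open>This form separates the contributions of real and imaginary part, so that each can be
  estimated alone.\<close>

lemma norm_sin_squared':
  "norm (sin z) ^ 2 = sin (Re z) ^ 2 + sinh (Im z) ^ 2" for z :: complex
proof -
  have "sinh (Im z) ^ 2 = (exp (2 * Im z) + inverse (exp (2 * Im z)) - 2) / 4"
    by (simp add: sinh_field_def power2_eq_square field_simps exp_minus flip: exp_add)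
  then show ?thesis
    unfolding norm_sin_squared cos_double_sin by (simp add: field_simps)
qed

lemma real_square_le_sinh_square: "x\<^sup>2 \<le> (sinh x)\<^sup>2" for x :: real
  using real_le_abs_sinh[of x] by (simp add: sinh_field_def exp_minus flip: abs_le_square_iff)

text \<open>The function t^2 - sin^2 t is nondecreasing for t \<ge> 0, its derivative being 2 t -
  sin(2 t).\<close>

lemma sin_square_diff_le:
  fixes x y :: real
  assumes "0 \<le> x" "x \<le> y"
  shows "(sin y)\<^sup>2 - (sin x)\<^sup>2 \<le> y\<^sup>2 - x\<^sup>2"
proof -
  have "x\<^sup>2 - (sin x)\<^sup>2 \<le> y\<^sup>2 - (sin y)\<^sup>2"
  proof (rule DERIV_nonneg_imp_nondecreasing[OF assms(2)])
    fix t assume t: "x \<le> t" "t \<le> y"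
    have "((\<lambda>t. t\<^sup>2 - (sin t)\<^sup>2) has_real_derivative 2 * t - sin (2 * t)) (at t)"
      by (auto intro!: derivative_eq_intros simp: sin_double)
    moreover have "sin (2 * t) \<le> 2 * t"
      using assms t by (intro sin_x_le_x) auto
    ultimately show "\<exists>d. ((\<lambda>t. t\<^sup>2 - (sin t)\<^sup>2) has_real_derivative d) (at t) \<and> 0 \<le> d"
      by (intro exI[of _ "2 * t - sin (2 * t)"]) auto
  qed
  then show ?thesis by simp
qed

text \<open>Let x + i y be in the strip |x| \<le> pi/2 but not in the open unit disc. Then |sin(x +
  i y)|^2 = sin^2 x + sinh^2 y is at least sin^2 1: if |x| \<le> 1, use sinh^2 y \<ge> y^2 \<ge> 1 -
  x^2 \<ge> sin^2 1 - sin^2 x; if |x| > 1, the first summand suffices.\<close>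

lemma norm_Arcsin_less_1:
  assumes "norm z < sin 1"
  shows "norm (Arcsin z) < 1"
proof (rule ccontr)
  define x y where "x = \<bar>Re (Arcsin z)\<bar>" "y = Im (Arcsin z)"
  assume "\<not> norm (Arcsin z) < 1"
  then have "1\<^sup>2 \<le> (norm (Arcsin z))\<^sup>2" by (intro power_mono) auto
  then have xy: "1 \<le> x\<^sup>2 + y\<^sup>2" by (simp add: x_y_def cmod_power2)
  \<comment> \<open>This keeps \<open>z\<close> off the branch cuts, so that \<open>Arcsin z\<close>
    lies in the strip.\<close>
  have z1: "\<bar>Re z\<bar> < 1"
    using assms abs_Re_le_cmod[of z] sin_le_one[of 1] by linarith
  have x: "0 \<le> x" "x \<le> pi / 2"
    using Arcsin_bounds[OF z1] by (auto simp: x_y_def)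
  have nz: "(norm z)\<^sup>2 = (sin x)\<^sup>2 + (sinh y)\<^sup>2"
    using norm_sin_squared'[of "Arcsin z"] by (simp add: x_y_def abs_if)
  have s1: "0 < sin (1::real)"
    using pi_gt3 by (intro sin_gt_zero) auto
  have "(sin 1)\<^sup>2 \<le> (norm z)\<^sup>2"
  proof (cases "x \<le> 1")
    case True
    then show ?thesis
      using sin_square_diff_le[OF x(1) True] xy real_square_le_sinh_square[of y] nz by simp
  next
    case False
    then have "sin 1 \<le> sin x"
      using x pi_gt3 by (intro sin_monotone_2pi_le) auto
    then have "(sin 1)\<^sup>2 \<le> (sin x)\<^sup>2" using s1 by (intro power_mono) auto
    then show ?thesis using nz zero_le_power2[of "sinh y"] by linarith
  qed
  moreover have "(norm z)\<^sup>2 < (sin 1)\<^sup>2"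
    using assms by (intro power_strict_mono) auto
  ultimately show False by simp
qed

text \<open>The witness is w = Arcsin(P - 1). It maps the disc into itself by
  \<open>norm_Arcsin_less_1\<close>, and w(0) = 0, so Schwarz' lemma yields |w(z)| \<le>
  |z|.\<close>

lemma subordinate_one_plus_sinI:
  assumes P: "P holomorphic_on unit_disc" "P 0 = 1"
    and bound: "\<And>z. z \<in> unit_disc \<Longrightarrow> norm (P z - 1) < sin 1"
  shows "P \<prec>\<^sub>s (\<lambda>z. 1 + sin z)"
proof -
  define w where "w = (\<lambda>z. Arcsin (P z - 1))"
  have "w = Arcsin \<circ> (\<lambda>z. P z - 1)" by (simp add: w_def fun_eq_iff)
  moreover have "(Arcsin \<circ> (\<lambda>z. P z - 1)) holomorphic_on unit_disc"
  proof (rule holomorphic_on_compose)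
    show "(\<lambda>z. P z - 1) holomorphic_on unit_disc" by (intro holomorphic_intros P)
    have "\<bar>Re (P z - 1)\<bar> < 1" if "z \<in> unit_disc" for z
      using bound[OF that] abs_Re_le_cmod[of "P z - 1"] sin_le_one[of 1] by linarith
    then show "Arcsin holomorphic_on (\<lambda>z. P z - 1) ` unit_disc"
      by (intro holomorphic_on_Arcsin) blast
  qed
  ultimately have w: "w holomorphic_on unit_disc" by simp
  have w0: "w 0 = 0" by (simp add: w_def P)
  have "norm (w z) \<le> norm z" if "z \<in> unit_disc" for z
    using Schwarz_Lemma(1)[OF w w0, of z] norm_Arcsin_less_1 bound that by (auto simp: w_def)
  with w w0 show ?thesis
    unfolding subordinate_def using P
    by (intro conjI exI[of _ w] holomorphic_intros) (auto simp: w_def)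
qed

section \<open>Numerical constants and the distance of the seven dominant functions from 1\<close>

lemma sin_1_ge: "5 / 6 \<le> sin (1::real)"
proof -
  have "\<bar>sin (1::real) - (\<Sum>m<7. sin_coeff m * 1 ^ m)\<bar> \<le> inverse (fact 7) * \<bar>1\<bar> ^ 7"
    by (rule Maclaurin_sin_bound)
  \<comment> \<open>The Taylor polynomial is 1 - 1/6 + 1/120 = 101/120, and the error 1/5040 is
    below 1/120.\<close>
  then have "\<bar>sin 1 - 101 / 120 :: real\<bar> \<le> 1 / 5040"
    by (simp add: sin_coeff_def lessThan_nat_numeral lessThan_Suc fact_numeral)
  then show ?thesis unfolding abs_le_iff by linarith
qed

text \<open>The upper bound is chosen because 5/9 = 2/3 * 5/6; with \<open>sin_1_ge\<close> it
  yields cos 1 \<le> 2/3 sin 1.\<close>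

lemma cos_1_bounds: "1 / 2 \<le> cos (1::real)" "cos (1::real) \<le> 5 / 9"
proof -
  have "cos (pi / 3) \<le> cos 1"
    using pi_gt3 by (intro cos_monotone_0_pi_le) auto
  then show "1 / 2 \<le> cos (1::real)" by (simp add: cos_60)
  have "(5 / 6)\<^sup>2 \<le> (sin (1::real))\<^sup>2"
    using sin_1_ge by (intro power_mono) auto
  then have "(cos (1::real))\<^sup>2 \<le> (5 / 9)\<^sup>2"
    using sin_cos_squared_add[of "1::real"] by (simp add: power2_eq_square)
  then show "cos (1::real) \<le> 5 / 9"
    by (rule power2_le_imp_le) simp
qed

lemma cos_ge_half_if_abs_le_1: "1 / 2 \<le> cos x" if "\<bar>x\<bar> \<le> 1" for x :: real
proof -
  have "cos 1 \<le> cos \<bar>x\<bar>"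
    using that pi_gt3 by (intro cos_monotone_0_pi_le) auto
  then show ?thesis using cos_1_bounds(1) by simp
qed

text \<open>The difference is (C - D) z / (1 + D z), whose denominator has modulus at least 1 -
  |D|.\<close>

lemma norm_Moebius_minus_1_less:
  fixes C D :: real and z :: complex
  assumes CD: "-1 < D" "D < C" "C \<le> 1" and z: "norm z < 1"
  shows "norm ((1 + of_real C * z) / (1 + of_real D * z) - 1) < (C - D) / (1 - \<bar>D\<bar>)"
proof -
  have D: "\<bar>D\<bar> < 1" using CD by auto
  have "\<bar>D\<bar> * norm z \<le> \<bar>D\<bar>" using z by (intro mult_left_le) auto
  moreover have "1 - \<bar>D\<bar> * norm z \<le> norm (1 + of_real D * z)"
    using norm_diff_ineq[of 1 "of_real D * z"] by (simp add: norm_mult)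
  ultimately have den: "1 - \<bar>D\<bar> \<le> norm (1 + of_real D * z)" by linarith
  then have nz: "1 + of_real D * z \<noteq> 0" using D by auto
  then have "(1 + of_real C * z) / (1 + of_real D * z) - 1 = of_real (C - D) * z / (1 + of_real D * z)"
    by (simp add: field_simps)
  then have "norm ((1 + of_real C * z) / (1 + of_real D * z) - 1) = (C - D) * norm z / norm (1 + of_real D * z)"
    using CD by (simp add: norm_mult norm_divide del: of_real_diff)
  also have "\<dots> \<le> (C - D) * norm z / (1 - \<bar>D\<bar>)"
    using CD D den by (intro divide_left_mono) (auto intro!: mult_pos_pos)
  also have "\<dots> < (C - D) / (1 - \<bar>D\<bar>)"
    using CD D z by (simp add: divide_strict_right_mono)
  finally show ?thesis .
qed

lemma exp_bounds_of_abs_less_1: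
  assumes "\<bar>x\<bar> < (1::real)"
  shows "exp x < 68 / 25" "exp (- x) < 68 / 25"
proof -
  have "exp x < exp 1" "exp (- x) < exp 1" using assms by auto
  moreover have "exp 1 < (68 / 25 :: real)" using e_less_272 by simp
  ultimately show "exp x < 68 / 25" "exp (- x) < 68 / 25" by linarith+
qed

lemma
  fixes z :: complex
  shows norm_exp_plus_1_squared: "(norm (exp z + 1))\<^sup>2 = (exp (Re z))\<^sup>2 + 2 * exp (Re z) * cos (Im z) + 1"
  and norm_exp_minus_1_squared: "(norm (exp z - 1))\<^sup>2 = (exp (Re z))\<^sup>2 - 2 * exp (Re z) * cos (Im z) + 1"
proof -
  have "(exp (Re z) * cos (Im z))\<^sup>2 + (exp (Re z) * sin (Im z))\<^sup>2 = (exp (Re z))\<^sup>2"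
    by (simp add: power_mult_distrib flip: distrib_left)
  then show "(norm (exp z + 1))\<^sup>2 = (exp (Re z))\<^sup>2 + 2 * exp (Re z) * cos (Im z) + 1"
    and "(norm (exp z - 1))\<^sup>2 = (exp (Re z))\<^sup>2 - 2 * exp (Re z) * cos (Im z) + 1"
    by (simp_all add: cmod_power2 Re_exp Im_exp power2_sum power2_diff)
qed

text \<open>The difference equals (e^z - 1)/(e^z + 1) = tanh(z/2), so the squared moduli of
  numerator and denominator are compared.\<close>

lemma norm_sigmoid_minus_1_less:
  fixes z :: complex
  assumes z: "norm z < 1"
  shows "norm (2 / (1 + exp (- z)) - 1) < 3 / 4"
proof -
  have xy: "\<bar>Re z\<bar> < 1" "\<bar>Im z\<bar> < 1"
    using z abs_Re_le_cmod[of z] abs_Im_le_cmod[of z] by linarith+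
  define E where "E = exp (Re z)"
  have "E > 0" by (simp add: E_def)
  have c: "1 / 2 \<le> cos (Im z)" using xy by (intro cos_ge_half_if_abs_le_1) simp
  have E1: "E \<le> 68/25"
    using exp_bounds_of_abs_less_1(1)[OF xy(1)] unfolding E_def by linarith
  \<comment> \<open>Since E lies between 25/68 and 68/25, the quadratic with these two roots is
    nonpositive at E. This bounds E + 1/E by 68/25 + 25/68 < 31/10.\<close>
  have "1 = E * exp (- Re z)" unfolding E_def by (simp flip: exp_add)
  also have "\<dots> \<le> E * (68/25)"
    using exp_bounds_of_abs_less_1(2)[OF xy(1)] \<open>E > 0\<close> by (intro mult_left_mono) linarith+
  finally have "(E - 68/25) * (E - 25/68) \<le> 0"
    using E1 by (intro mult_nonpos_nonneg) linarith+
  then have "E\<^sup>2 + 1 \<le> (68/25 + 25/68) * E" by (simp add: algebra_simps power2_eq_square)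
  also have "\<dots> \<le> 31/10 * E" using \<open>E > 0\<close> by (intro mult_right_mono) auto
  finally have E: "E\<^sup>2 + 1 \<le> 31/10 * E" .
  have Ec: "E * (1 / 2) \<le> E * cos (Im z)" using c \<open>E > 0\<close> by (intro mult_left_mono) auto
  have nz: "exp z + 1 \<noteq> 0"
  proof
    assume "exp z + 1 = 0"
    then have "(norm (exp z + 1))\<^sup>2 = 0" by simp
    then have "E\<^sup>2 + 2 * (E * cos (Im z)) + 1 = 0"
      unfolding norm_exp_plus_1_squared by (simp add: E_def)
    then show False using Ec \<open>E > 0\<close> zero_le_power2[of E] by linarith
  qed
  \<comment> \<open>Cleared of fractions this reads 7 (E^2 + 1) < 50 E cos y with y =
    \<open>Im z\<close>. The left side is at most 21.7 E, the right side at least 25 E.\<close>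
  have "E\<^sup>2 - 2 * (E * cos (Im z)) + 1 < 9 / 16 * (E\<^sup>2 + 2 * (E * cos (Im z)) + 1)"
  proof -
    define Q q where "Q = E\<^sup>2" and "q = E * cos (Im z)"
    have "Q + 1 \<le> 31/10 * E" "E / 2 \<le> q" using E Ec by (simp_all add: Q_def q_def)
    then have "Q - 2 * q + 1 < 9/16 * (Q + 2 * q + 1)" using \<open>E > 0\<close> by argo
    then show ?thesis by (simp only: Q_def q_def)
  qed
  then have "(norm (exp z - 1))\<^sup>2 < (3 / 4)\<^sup>2 * (norm (exp z + 1))\<^sup>2"
    unfolding norm_exp_minus_1_squared norm_exp_plus_1_squared E_def[symmetric] mult.assoc
    by (simp add: power_divide)
  then have "(norm (exp z - 1))\<^sup>2 < (3 / 4 * norm (exp z + 1))\<^sup>2"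
    by (simp only: power_mult_distrib)
  then have lt: "norm (exp z - 1) < 3 / 4 * norm (exp z + 1)"
    by (rule power2_less_imp_less) simp
  have e: "exp z * exp (- z) = 1" by (rule exp_minus_inverse)
  have "1 + exp (- z) = (exp z + 1) * exp (- z)" using e by (simp add: algebra_simps)
  then have nz': "1 + exp (- z) \<noteq> 0" using nz by simp
  have "(1 - exp (- z)) * (exp z + 1) = (exp z - 1) * (1 + exp (- z))"
    using e by algebra
  then have "(1 - exp (- z)) / (1 + exp (- z)) = (exp z - 1) / (exp z + 1)"
    by (subst frac_eq_eq[OF nz' nz])
  moreover have "2 / (1 + exp (- z)) - 1 = (1 - exp (- z)) / (1 + exp (- z))"
    using nz' by (simp add: divide_simps)
  ultimately have "2 / (1 + exp (- z)) - 1 = (exp z - 1) / (exp z + 1)" by simp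
  then have "norm (2 / (1 + exp (- z)) - 1) = norm (exp z - 1) / norm (exp z + 1)"
    by (simp add: norm_divide)
  also have "\<dots> < 3 / 4" using lt nz by (simp add: divide_less_eq)
  finally show ?thesis .
qed

text \<open>For the root s, s - 1 = z^2 / (s + 1), and |s + 1| \<ge> 1 as Re s \<ge> 0; so |s - 1|
  \<le> 1, and |z| < 1 is added.\<close>

lemma norm_crescent_minus_1_less:
  assumes z: "norm z < 1"
  shows "norm (z + csqrt (1 + z\<^sup>2) - 1) < 2"
proof -
  define s where "s = csqrt (1 + z\<^sup>2)"
  have s2: "s\<^sup>2 = 1 + z\<^sup>2" by (simp add: s_def)
  have "Re s \<ge> 0" unfolding s_def by (rule Re_csqrt)
  then have "1 \<le> norm (s + 1)" using complex_Re_le_cmod[of "s + 1"] by simp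
  then have "norm (s - 1) * 1 \<le> norm (s - 1) * norm (s + 1)" by (intro mult_left_mono) auto
  also have "\<dots> = norm (s\<^sup>2 - 1)"
    by (simp add: norm_mult[symmetric] algebra_simps power2_eq_square)
  also have "\<dots> = (norm z)\<^sup>2" by (simp add: s2 norm_power)
  also have "\<dots> \<le> 1" using z by (simp add: power_le_one)
  finally have "norm (s - 1) \<le> 1" by simp
  then show ?thesis using norm_triangle_ineq[of z "s - 1"] z by (simp add: s_def algebra_simps)
qed

lemma norm_times_exp_less:
  fixes z :: complex
  assumes z: "norm z < 1"
  shows "norm (1 + z * exp z - 1) < exp 1"
proof -
  have "norm (z * exp z) \<le> 1 * exp (Re z)"
    unfolding norm_mult norm_exp_eq_Re using z by (intro mult_right_mono) auto
  also have "\<dots> < exp 1" using z complex_Re_le_cmod[of z] by simp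
  finally show ?thesis by simp
qed

text \<open>For v = arsinh z, sin(i v) = i z bounds |Re v| by 1 through sinh. Moreover e^v + e^(-v)
  is twice the principal root, whose real part is nonnegative, so cos(Im v) \<ge> 0 and |Im v| \<le>
  pi/2.\<close>

lemma norm_arsinh_less:
  fixes z :: complex
  assumes z: "norm z < 1"
  shows "norm (arsinh z) < 2"
proof -
  define s where "s = csqrt (1 + z\<^sup>2)"
  have s2: "s\<^sup>2 = 1 + z\<^sup>2" by (simp add: s_def)
  have prod: "(s + z) * (s - z) = 1" using s2 by (simp add: algebra_simps power2_eq_square)
  then have nz: "s + z \<noteq> 0" by auto
  define v where "v = arsinh z"
  have "v = Ln (s + z)" by (simp add: v_def arsinh_complex s_def add.commute)
  then have ev: "exp v = s + z" using nz by simp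
  then have emv: "exp (- v) = s - z"
    using prod nz by (simp add: exp_minus field_simps)
  have "sin (\<i> * v) = \<i> * z"
    by (simp add: sin_exp_eq ev emv mult.assoc[symmetric]) 
  then have "(norm z)\<^sup>2 = (sin (Im v))\<^sup>2 + (sinh (Re v))\<^sup>2"
    using norm_sin_squared'[of "\<i> * v"] by (simp add: norm_mult)
  moreover have "(norm z)\<^sup>2 \<le> 1" using z by (simp add: power_le_one)
  ultimately have re: "(Re v)\<^sup>2 \<le> 1"
    using real_square_le_sinh_square[of "Re v"] zero_le_power2[of "sin (Im v)"] by linarith
  have "0 \<le> Re s" unfolding s_def by (rule Re_csqrt)
  then have "0 \<le> Re (exp v + exp (- v))" by (simp add: ev emv)
  then have "0 \<le> (exp (Re v) + exp (- Re v)) * cos (Im v)"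
    by (simp add: Re_exp algebra_simps)
  moreover have "exp (Re v) + exp (- Re v) > 0" by (simp add: add_pos_pos)
  ultimately have cos: "0 \<le> cos (Im v)" by (simp add: zero_le_mult_iff)
  have "\<bar>Im v\<bar> \<le> pi"
    using mpi_less_Im_Ln[OF nz] Im_Ln_le_pi[OF nz] \<open>v = Ln (s + z)\<close> by auto
  have im: "\<bar>Im v\<bar> \<le> pi / 2"
  proof (rule ccontr)
    assume "\<not> \<bar>Im v\<bar> \<le> pi / 2"
    then have "cos \<bar>Im v\<bar> < cos (pi / 2)"
      using \<open>\<bar>Im v\<bar> \<le> pi\<close> by (intro cos_monotone_0_pi) auto
    then show False using cos by simp
  qed
  also have "\<dots> < 8 / 5" using pi_approx by simp
  finally have "\<bar>Im v\<bar>\<^sup>2 < (8 / 5)\<^sup>2" by (intro power_strict_mono) auto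
  \<comment> \<open>Numerically 1 + (8/5)^2 = 89/25 < 4.\<close>
  then have "(norm v)\<^sup>2 < 2\<^sup>2"
    using re by (simp add: cmod_power2 power_divide)
  then show ?thesis unfolding v_def by (rule power2_less_imp_less) simp
qed

lemma norm_exp_minus_1_less:
  fixes z :: complex
  assumes z: "norm z < 1"
  shows "norm (exp z - 1) < 3 / 2 * (exp 1 - 1)"
proof -
  have xy: "\<bar>Re z\<bar> < 1" "\<bar>Im z\<bar> < 1"
    using z abs_Re_le_cmod[of z] abs_Im_le_cmod[of z] by linarith+
  define E where "E = exp (Re z)"
  have "E > 0" by (simp add: E_def)
  have e: "5 / 2 \<le> exp (1::real)" using exp_lower_Taylor_quadratic[of 1] by simp
  have "E \<le> exp 1" using xy by (simp add: E_def)
  have c: "1 / 2 \<le> cos (Im z)" using xy by (intro cos_ge_half_if_abs_le_1) simp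
  have "E * (1 / 2) \<le> E * cos (Im z)" using c \<open>E > 0\<close> by (intro mult_left_mono) auto
  then have "(norm (exp z - 1))\<^sup>2 \<le> E\<^sup>2 - E + 1"
    unfolding norm_exp_minus_1_squared E_def[symmetric] by simp
  also have "\<dots> \<le> (exp 1)\<^sup>2 - exp 1 + 1"
  proof -
    have "0 \<le> (exp 1 - E) * (exp 1 + E - 1)"
      using \<open>E \<le> exp 1\<close> \<open>E > 0\<close> e by (intro mult_nonneg_nonneg) auto
    then show ?thesis by (simp add: algebra_simps power2_eq_square)
  qed
  also have "\<dots> < (3 / 2 * (exp 1 - 1))\<^sup>2"
  proof -
    \<comment> \<open>With e = exp 1, four times the difference of the two sides is 5 e^2 - 14 e +
      5; the expression here is 5 e^2 - 14 e + 4, factored at the lower bound 5/2 of e.\<close>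
    have "0 < (exp 1 - 5/2) * (5 * exp 1 - 3/2) + 1 / (4::real)"
      using e by (intro add_nonneg_pos mult_nonneg_nonneg) auto
    then show ?thesis by (simp add: algebra_simps power2_eq_square)
  qed
  finally show ?thesis by (rule power2_less_imp_less) (use e in simp)
qed

text \<open>Bounding sin^2(Re z) by 1 leaves 1 + sinh^2 = cosh^2 at Im z.\<close>

lemma norm_sin_less_cosh_1:
  fixes z :: complex
  assumes z: "norm z < 1"
  shows "norm (sin z) < cosh 1"
proof -
  have "(norm (sin z))\<^sup>2 \<le> 1 + (sinh (Im z))\<^sup>2"
    unfolding norm_sin_squared' by (simp add: abs_square_le_1)
  also have "\<dots> = (cosh \<bar>Im z\<bar>)\<^sup>2" by (simp add: cosh_square_eq)
  also have "\<dots> < (cosh 1)\<^sup>2"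
  proof (rule power_strict_mono)
    show "cosh \<bar>Im z\<bar> < cosh 1"
      using z abs_Im_le_cmod[of z] by (subst cosh_real_nonneg_less_iff) auto
  qed auto
  finally show ?thesis by (rule power2_less_imp_less) simp
qed

section \<open>The thresholds and the seven conditions\<close>

lemma \<nu>_bounds: "\<nu>\<^sub>0 = cos 1" "\<nu>\<^sub>1 < 0"
proof -
  have "1 - (sin (1::real))\<^sup>2 = (cos 1)\<^sup>2" by (simp add: cos_squared_eq)
  then show "\<nu>\<^sub>0 = cos 1" using cos_1_bounds unfolding \<nu>\<^sub>0_def by simp
  have "sin (2::real) > 0" using pi_gt3 by (intro sin_gt_zero) auto
  moreover have "1 + cos (2::real) = 2 * (cos 1)\<^sup>2"
    using cos_double_cos[of "1::real"] by simp
  then have "1 + cos (2::real) > 0" using cos_1_bounds by (simp add: zero_less_power2)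
  ultimately show "\<nu>\<^sub>1 < 0" unfolding \<nu>\<^sub>1_def by (simp add: zero_less_divide_iff)
qed

text \<open>As cot 1 \<le> 2/3, a positive r < 1/2 would give r^2 + 2 cot(1) r < 1/4 + 2/3 <
  1.\<close>

lemma r\<^sub>0_ge: "1 / 2 \<le> r\<^sub>0"
proof (rule ccontr)
  have r: "r\<^sub>0 > 0" "r\<^sub>0\<^sup>2 + 2 * cot 1 * r\<^sub>0 - 1 = 0"
    using theI'[OF r\<^sub>0_well_defined] unfolding r\<^sub>0_def by auto
  have "cot (1::real) \<le> 2 / 3"
    using sin_1_ge cos_1_bounds by (simp add: cot_def divide_le_eq)
  assume "\<not> 1 / 2 \<le> r\<^sub>0"
  then have "r\<^sub>0 * r\<^sub>0 < 1/2 * (1/2)" using r by (intro mult_strict_mono) auto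
  moreover have "cot 1 * r\<^sub>0 \<le> 2/3 * (1/2)"
    using \<open>cot 1 \<le> 2/3\<close> r \<open>\<not> 1 / 2 \<le> r\<^sub>0\<close> by (intro mult_mono) auto
  ultimately show False using r(2) by (simp add: power2_eq_square)
qed

text \<open>The thresholds contain cos 1, while the disc to be reached has radius sin 1 \<ge> 3/2
  cos 1. This leaves a factor 3/2 to spare, which makes crude values of \<open>K\<close>
  sufficient.\<close>

lemma starlike_sinI:
  assumes f: "f \<in> class_A" and \<beta>: "\<beta>\<^sub>1 > 0" "\<beta>\<^sub>2 > 0"
    and sub: "S_expr \<beta>\<^sub>1 \<beta>\<^sub>2 f \<prec>\<^sub>s h" and h0: "h 0 = 1"
    and hK: "\<And>\<zeta>. norm \<zeta> < 1 \<Longrightarrow> norm (h \<zeta> - 1) < K"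
    and K: "K \<le> 3 / 2 * (\<nu>\<^sub>0 * (\<beta>\<^sub>1 + \<beta>\<^sub>2 * \<nu>\<^sub>1))"
  shows "f \<in> starlike_sin"
proof -
  obtain w where S: "S_expr \<beta>\<^sub>1 \<beta>\<^sub>2 f holomorphic_on unit_disc"
    and w: "w 0 = 0" "\<And>z. z \<in> unit_disc \<Longrightarrow> norm (w z) \<le> norm z"
    and Sw: "\<And>z. z \<in> unit_disc \<Longrightarrow> S_expr \<beta>\<^sub>1 \<beta>\<^sub>2 f z = h (w z)"
    using sub unfolding subordinate_def by blast
  have S0: "S_expr \<beta>\<^sub>1 \<beta>\<^sub>2 f 0 = 1" using Sw[of 0] w h0 by simp
  have SK: "norm (S_expr \<beta>\<^sub>1 \<beta>\<^sub>2 f z - 1) < K" if "z \<in> unit_disc" for z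
    using hK[of "w z"] w(2)[OF that] Sw[OF that] that by simp
  have p: "S_quot 1 f holomorphic_on unit_disc" "S_quot 1 f 0 = 1"
    "\<And>z. z \<in> unit_disc \<Longrightarrow> norm (S_quot 1 f z - 1) \<le> K / \<beta>\<^sub>1 * norm z"
    using S_quot_1_deviation[OF f \<beta> S S0] SK by blast+
  have "\<nu>\<^sub>0 * (\<beta>\<^sub>1 + \<beta>\<^sub>2 * \<nu>\<^sub>1) \<le> cos 1 * \<beta>\<^sub>1"
    using \<beta> \<nu>_bounds cos_1_bounds by (simp add: mult_le_0_iff)
  moreover have "cos 1 * \<beta>\<^sub>1 \<le> 2 / 3 * sin 1 * \<beta>\<^sub>1"
    using \<beta> sin_1_ge cos_1_bounds by (intro mult_right_mono) auto
  ultimately have "K \<le> sin 1 * \<beta>\<^sub>1"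
    using K by linarith
  then have "K / \<beta>\<^sub>1 \<le> sin 1"
    using \<beta> by (simp add: divide_le_eq)
  have "norm (S_quot 1 f z - 1) < sin 1" if z: "z \<in> unit_disc" for z
  proof -
    have "norm (S_quot 1 f z - 1) \<le> sin 1 * norm z"
      using p(3)[OF z] mult_right_mono[OF \<open>K / \<beta>\<^sub>1 \<le> sin 1\<close>, of "norm z"] by simp
    also have "\<dots> < sin 1" using z sin_1_ge by simp
    finally show ?thesis .
  qed
  with p show ?thesis
    unfolding starlike_sin_def using f by (blast intro: subordinate_one_plus_sinI)
qed

theorem corollary2p10:
  fixes \<beta>\<^sub>1 \<beta>\<^sub>2 :: real and f :: "complex \<Rightarrow> complex"
  assumes "\<beta>\<^sub>1 > 0" and "\<beta>\<^sub>2 > 0" and "f \<in> class_A"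
    and "(\<exists>C D :: real. -1 < D \<and> D < C \<and> C \<le> 1 \<and>
            S_expr \<beta>\<^sub>1 \<beta>\<^sub>2 f \<prec>\<^sub>s (\<lambda>z. (1 + of_real C * z) / (1 + of_real D * z)) \<and>
            \<nu>\<^sub>0 * (\<beta>\<^sub>1 + \<beta>\<^sub>2 * \<nu>\<^sub>1) * (1 - D\<^sup>2) \<ge> (C - D) * (1 + \<bar>D\<bar>))
       \<or> (S_expr \<beta>\<^sub>1 \<beta>\<^sub>2 f \<prec>\<^sub>s (\<lambda>z. 2 / (1 + exp (- z))) \<and>
            \<nu>\<^sub>0 * (\<beta>\<^sub>1 + \<beta>\<^sub>2 * \<nu>\<^sub>1) \<ge> r\<^sub>0)
       \<or> (S_expr \<beta>\<^sub>1 \<beta>\<^sub>2 f \<prec>\<^sub>s (\<lambda>z. z + csqrt (1 + z\<^sup>2)) \<and>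
            \<nu>\<^sub>0 * (\<beta>\<^sub>1 + \<beta>\<^sub>2 * \<nu>\<^sub>1) \<ge> sqrt 2)
       \<or> (S_expr \<beta>\<^sub>1 \<beta>\<^sub>2 f \<prec>\<^sub>s (\<lambda>z. 1 + z * exp z) \<and>
            \<nu>\<^sub>0 * (\<beta>\<^sub>1 + \<beta>\<^sub>2 * \<nu>\<^sub>1) \<ge> exp 1)
       \<or> (S_expr \<beta>\<^sub>1 \<beta>\<^sub>2 f \<prec>\<^sub>s (\<lambda>z. 1 + arsinh z) \<and>
            2 * \<nu>\<^sub>0 * (\<beta>\<^sub>1 + \<beta>\<^sub>2 * \<nu>\<^sub>1) \<ge> pi)
       \<or> (S_expr \<beta>\<^sub>1 \<beta>\<^sub>2 f \<prec>\<^sub>s (\<lambda>z. exp z) \<and>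
            \<nu>\<^sub>0 * (\<beta>\<^sub>1 + \<beta>\<^sub>2 * \<nu>\<^sub>1) \<ge> exp 1 - 1)
       \<or> (S_expr \<beta>\<^sub>1 \<beta>\<^sub>2 f \<prec>\<^sub>s (\<lambda>z. 1 + sin z) \<and>
            \<nu>\<^sub>0 * (\<beta>\<^sub>1 + \<beta>\<^sub>2 * \<nu>\<^sub>1) \<ge> sinh 1)"
  shows "f \<in> starlike_sin"
proof -
  note star = starlike_sinI[OF assms(3,1,2)]
  consider
    (i) C D :: real where "-1 < D" "D < C" "C \<le> 1"
      "S_expr \<beta>\<^sub>1 \<beta>\<^sub>2 f \<prec>\<^sub>s (\<lambda>z. (1 + of_real C * z) / (1 + of_real D * z))"
      "\<nu>\<^sub>0 * (\<beta>\<^sub>1 + \<beta>\<^sub>2 * \<nu>\<^sub>1) * (1 - D\<^sup>2) \<ge> (C - D) * (1 + \<bar>D\<bar>)"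
  | (ii) "S_expr \<beta>\<^sub>1 \<beta>\<^sub>2 f \<prec>\<^sub>s (\<lambda>z. 2 / (1 + exp (- z)))" "\<nu>\<^sub>0 * (\<beta>\<^sub>1 + \<beta>\<^sub>2 * \<nu>\<^sub>1) \<ge> r\<^sub>0"
  | (iii) "S_expr \<beta>\<^sub>1 \<beta>\<^sub>2 f \<prec>\<^sub>s (\<lambda>z. z + csqrt (1 + z\<^sup>2))" "\<nu>\<^sub>0 * (\<beta>\<^sub>1 + \<beta>\<^sub>2 * \<nu>\<^sub>1) \<ge> sqrt 2"
  | (iv) "S_expr \<beta>\<^sub>1 \<beta>\<^sub>2 f \<prec>\<^sub>s (\<lambda>z. 1 + z * exp z)" "\<nu>\<^sub>0 * (\<beta>\<^sub>1 + \<beta>\<^sub>2 * \<nu>\<^sub>1) \<ge> exp 1"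
  | (v) "S_expr \<beta>\<^sub>1 \<beta>\<^sub>2 f \<prec>\<^sub>s (\<lambda>z. 1 + arsinh z)" "2 * \<nu>\<^sub>0 * (\<beta>\<^sub>1 + \<beta>\<^sub>2 * \<nu>\<^sub>1) \<ge> pi"
  | (vi) "S_expr \<beta>\<^sub>1 \<beta>\<^sub>2 f \<prec>\<^sub>s (\<lambda>z. exp z)" "\<nu>\<^sub>0 * (\<beta>\<^sub>1 + \<beta>\<^sub>2 * \<nu>\<^sub>1) \<ge> exp 1 - 1"
  | (vii) "S_expr \<beta>\<^sub>1 \<beta>\<^sub>2 f \<prec>\<^sub>s (\<lambda>z. 1 + sin z)" "\<nu>\<^sub>0 * (\<beta>\<^sub>1 + \<beta>\<^sub>2 * \<nu>\<^sub>1) \<ge> sinh 1"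
    using assms(4) by blast
  then show ?thesis
  proof cases
    case i
    let ?\<nu> = "\<nu>\<^sub>0 * (\<beta>\<^sub>1 + \<beta>\<^sub>2 * \<nu>\<^sub>1)"
    have D: "\<bar>D\<bar> < 1" using i by auto
    \<comment> \<open>Cancelling 1 + |D| turns the condition into a lower bound by (C - D)/(1 -
      |D|), the radius from \<open>norm_Moebius_minus_1_less\<close>.\<close>
    have "1 - D\<^sup>2 = (1 - \<bar>D\<bar>) * (1 + \<bar>D\<bar>)"
      by (simp add: algebra_simps power2_eq_square)
    then have "(C - D) * (1 + \<bar>D\<bar>) \<le> (?\<nu> * (1 - \<bar>D\<bar>)) * (1 + \<bar>D\<bar>)"
      using i(5) by (simp only: mult.assoc)
    then have "C - D \<le> ?\<nu> * (1 - \<bar>D\<bar>)"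
      by (rule mult_right_le_imp_le) simp
    then have le: "(C - D) / (1 - \<bar>D\<bar>) \<le> ?\<nu>"
      using D by (simp add: divide_le_eq)
    moreover have "0 \<le> (C - D) / (1 - \<bar>D\<bar>)" using i D by simp
    ultimately have "(C - D) / (1 - \<bar>D\<bar>) \<le> 3 / 2 * ?\<nu>" by linarith
    then show ?thesis
      by (intro star[OF i(4) _ norm_Moebius_minus_1_less[OF i(1-3)]]) auto
  next
    case ii
    \<comment> \<open>The radius 3/4 is 3/2 times the lower bound 1/2 of
      \<open>r\<^sub>0\<close>.\<close>
    show ?thesis
      by (rule star[OF ii(1) _ norm_sigmoid_minus_1_less]) (use ii(2) r\<^sub>0_ge in auto)
  next
    case iii
    \<comment> \<open>The radius is 2 = 3/2 * 4/3.\<close>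
    have "4 / 3 \<le> sqrt 2" by (rule real_le_rsqrt) (simp add: power2_eq_square)
    then show ?thesis
      by (intro star[OF iii(1) _ norm_crescent_minus_1_less]) (use iii(2) in auto)
  next
    case iv
    have "0 < exp (1::real)" by simp
    then have "exp 1 \<le> 3 / 2 * (\<nu>\<^sub>0 * (\<beta>\<^sub>1 + \<beta>\<^sub>2 * \<nu>\<^sub>1))" using iv(2) by linarith
    then show ?thesis
      by (intro star[OF iv(1) _ norm_times_exp_less]) auto
  next
    case v
    \<comment> \<open>Here 3/2 * pi/2 > 9/4.\<close>
    have "2 \<le> 3 / 2 * (\<nu>\<^sub>0 * (\<beta>\<^sub>1 + \<beta>\<^sub>2 * \<nu>\<^sub>1))" using v(2) pi_gt3 by linarith
    then show ?thesis
      by (intro star[where K = 2, OF v(1)]) (simp_all add: norm_arsinh_less)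
  next
    case vi
    show ?thesis
      by (rule star[OF vi(1) _ norm_exp_minus_1_less]) (use vi(2) in auto)
  next
    case vii
    \<comment> \<open>The comparison of cosh 1 with 3/2 sinh 1 amounts to e^2 \<ge> 5, and (5/2)^2
      exceeds 5.\<close>
    have "5 / 2 \<le> exp (1::real)" using exp_lower_Taylor_quadratic[of 1] by simp
    then have "(5 / 2) * (5 / 2) \<le> exp (1::real) * exp 1" by (intro mult_mono) auto
    then have "cosh 1 \<le> 3 / 2 * sinh (1::real)"
      by (simp add: cosh_field_def sinh_field_def exp_minus field_simps)
    then show ?thesis
      by (intro star[where K = "cosh 1", OF vii(1)]) (use vii(2) norm_sin_less_cosh_1 in auto)
  qed
qed

end
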